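(* Let $H$ be a Lie subgroup of $\mathrm{GL}(d)=\mathrm{GL}(d,\mathbf R)$, and consider the affine space $M=\mathbf R^d$ as a homogeneous space for $G=H\ltimes\mathbf R^d$ acting by $(h,a)\cdot x=hx+a$, with origin $0$ and isotropy group $H$. If the isotropy group $H$ contains the scalings (so that $\mathrm{Id}\in\mathfrak h$, the Lie algebra of $H$), then the only reductive structure is $\mathfrak m=\mathbf R^d$. The only connection is then given by $$\langle\omega,\delta x\rangle_x=\begin{bmatrix}0&\delta x\\0&0\end{bmatrix}.$$
   Context: Elements of $G=H\ltimes\mathbf R^d$ are represented by matrices $\begin{bmatrix}h&a\\0&1\end{bmatrix}$ with $h\in H$, $a\in\mathbf R^d$, and elements of its Lie algebra $\mathfrak g$ by $\begin{bmatrix}A&b\\0&0\end{bmatrix}$ with $A\in\mathfrak h$, $b\in\mathbf R^d$. The subspace $\mathbf R^d\subset\mathfrak g$ denotes the translations, i.e. the matrices with $A=0$. Scalings are the matrices $\lambda\,\mathrm{Id}$ with $\lambda>0$. For a Lie group $G$ with Lie algebra $\mathfrak g$ acting smoothly and transitively on $M$ (infinitesimal action $\xi\cdot x\in T_xM$, tangent map $Tg$ of $x\mapsto g\cdot x$, adjoint action $g\cdot\xi=g\xi g^{-1}$), with isotropy group $H$ at the origin and Lie algebra $\mathfrak h$ of $H$: a connection is a $\mathfrak g$-valued one-form $\omega\in\Omega^1(M,\mathfrak g)$ such that $\langle\omega,f\rangle_x\cdot x=f$ for all $x\in M$, $f\in T_xM$, and $\langle\omega,Tg\,f\rangle_{g\cdot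 x}=g\cdot\langle\omega,f\rangle_x$ for all $g\in G$; a reductive structure is a subspace $\mathfrak m\subset\mathfrak g$ with $\mathfrak g=\mathfrak h\oplus\mathfrak m$ and $H\cdot\mathfrak m\subset\mathfrak m$. *)

theory Defs
  imports "HOL-Analysis.Analysis" "HOL-Algebra.Group"
begin

subsection \<open>Smooth maps\<close>

text \<open>Only meant for open sets \<open>S\<close>: derivatives are taken in the ambient space.\<close>

primrec Ck_on :: "nat \<Rightarrow> 'a::real_normed_vector set \<Rightarrow> ('a \<Rightarrow> 'b::real_normed_vector) \<Rightarrow> bool" where
  "Ck_on 0 S f \<longleftrightarrow> continuous_on S f"
| "Ck_on (Suc k) S f \<longleftrightarrow>
     (\<forall>x\<in>S. f differentiable (at x)) \<and> (\<forall>v. Ck_on k S (\<lambda>x. frechet_derivative f (at x) v))"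

definition smooth_on :: "'a::real_normed_vector set \<Rightarrow> ('a \<Rightarrow> 'b::real_normed_vector) \<Rightarrow> bool" where
  "smooth_on S f \<longleftrightarrow> (\<forall>k. Ck_on k S f)"

subsection \<open>Lie subgroups of the general linear group\<close>

definition GL :: "(real^'d^'d) monoid" where
  "GL = \<lparr>carrier = {A. invertible A}, mult = (**), one = mat 1\<rparr>"

lemma group_GL: "group (GL :: (real^'d^'d) monoid)"
proof (rule groupI)
  fix A :: "real^'d^'d" assume "A \<in> carrier GL"
  then obtain B where "A ** B = mat 1" "B ** A = mat 1"
    by (auto simp: GL_def invertible_def)
  then show "\<exists>B\<in>carrier GL. B \<otimes>\<^bsub>GL\<^esub> A = \<one>\<^bsub>GL\<^esub>"
    by (auto simp: GL_def invertible_def)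
qed (auto simp: GL_def invertible_mult matrix_mul_assoc invertible_def[of "mat 1"])

text \<open>Embedded submanifolds of a Euclidean space, by slice charts.\<close>

definition embedded_submanifold :: "'a::euclidean_space set \<Rightarrow> bool" where
  "embedded_submanifold W \<longleftrightarrow>
     (\<forall>p\<in>W. \<exists>U U' \<Psi> \<Phi> V. open U \<and> open U' \<and> p \<in> U \<and> subspace (V::'a set) \<and>
        homeomorphism U U' \<Psi> \<Phi> \<and> smooth_on U \<Psi> \<and> smooth_on U' \<Phi> \<and>
        \<Psi> ` (W \<inter> U) = V \<inter> U')"

text \<open>Immersed submanifolds: the manifold topology \<open>X\<close> may be finer than the
  Euclidean subspace topology. Since an injective immersion is locally an embedding, the condition
  is that every point has an \<open>X\<close>-open neighbourhood that is an embedded submanifold and on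
  which \<open>X\<close> is the Euclidean topology; the smooth structure of \<open>S\<close> is the one determined
  by these neighbourhoods.\<close>

definition immersed_submanifold :: "'a::euclidean_space set \<Rightarrow> 'a topology \<Rightarrow> bool" where
  "immersed_submanifold S X \<longleftrightarrow>
     topspace X = S \<and> Hausdorff_space X \<and> second_countable X \<and>
     (\<forall>p\<in>S. \<exists>W. openin X W \<and> p \<in> W \<and> embedded_submanifold W \<and>
        subtopology X W = top_of_set W)"

text \<open>Lie subgroups are not required to be closed. A map into an immersed submanifold is smooth
  iff it is smooth as a map into the ambient space and continuous for the manifold topology.
  Multiplication and inversion of matrices being smooth, the Lie group
  axioms therefore amount to the continuity conditions below.\<close>

definition lie_subgroup :: "(real^'d^'d) set \<Rightarrow> (real^'d^'d) topology \<Rightarrow> bool" where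
  "lie_subgroup H X \<longleftrightarrow>
     subgroup H GL \<and> immersed_submanifold H X \<and>
     continuous_map (prod_topology X X) X (\<lambda>(A, B). A ** B) \<and>
     continuous_map X X matrix_inv"

text \<open>The tangent space at the identity, as the set of velocities of smooth curves in \<open>H\<close>.\<close>

definition lie_algebra :: "(real^'d^'d) topology \<Rightarrow> (real^'d^'d) set" where
  "lie_algebra X = {A. \<exists>\<epsilon>>0. \<exists>c::real \<Rightarrow> real^'d^'d.
     smooth_on {-\<epsilon><..<\<epsilon>} c \<and> continuous_map (top_of_set {-\<epsilon><..<\<epsilon>}) X c \<and>
     c 0 = mat 1 \<and> (c has_vector_derivative A) (at 0)}"

subsection \<open>The affine group \<open>H \<ltimes> \<real>\<^sup>d\<close>\<close>

text \<open>The block matrix with rows \<open>(A, b)\<close> and \<open>(0, s)\<close>; the index \<open>Inr ()\<close> is the last one.\<close>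

definition block :: "real^'d^'d \<Rightarrow> real^'d \<Rightarrow> real \<Rightarrow> real^('d + unit)^('d + unit)" where
  "block A b s = (\<chi> i j. case i of
      Inl k \<Rightarrow> (case j of Inl l \<Rightarrow> A $ k $ l | Inr _ \<Rightarrow> b $ k)
    | Inr _ \<Rightarrow> (case j of Inl l \<Rightarrow> 0 | Inr _ \<Rightarrow> s))"

definition aff_group :: "(real^'d^'d) set \<Rightarrow> (real^('d + unit)^('d + unit)) set" where
  "aff_group H = {block h a 1 |h a. h \<in> H}"

definition aff_algebra :: "(real^'d^'d) topology \<Rightarrow> (real^('d + unit)^('d + unit)) set" where
  "aff_algebra X = {block A b 0 |A b. A \<in> lie_algebra X}"

definition translation_space :: "(real^('d::finite + unit)^('d + unit)) set" where
  "translation_space = {block 0 b 0 |b. True}"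

definition homog :: "real^'d \<Rightarrow> real^('d + unit)" where
  "homog x = (\<chi> i. case i of Inl k \<Rightarrow> x $ k | Inr _ \<Rightarrow> 1)"

definition aff_act :: "real^('d + unit)^('d + unit) \<Rightarrow> real^'d \<Rightarrow> real^'d" where
  "aff_act g x = (\<chi> k. (g *v homog x) $ Inl k)"

lemma aff_act_nth:
  fixes x :: "real^'d"
  shows "aff_act g x $ k = (\<Sum>l\<in>UNIV. g $ Inl k $ Inl l * x $ l) + g $ Inl k $ Inr ()"
proof -
  have U: "(UNIV :: ('d + unit) set) = range Inl \<union> {Inr ()}"
    using UNIV_sum UNIV_unit by auto
  have "sum f (UNIV :: ('d + unit) set) = (\<Sum>l\<in>UNIV. f (Inl l)) + f (Inr ())"
    for f :: "'d + unit \<Rightarrow> real"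
    unfolding U by (subst sum.union_disjoint) (auto simp: sum.reindex)
  then show ?thesis
    by (simp add: aff_act_def homog_def matrix_vector_mult_def)
qed

lemma aff_act_block: "aff_act (block h a s) x = h *v x + a"
  by (simp add: vec_eq_iff aff_act_nth block_def matrix_vector_mult_def)

text \<open>\<open>Tg f\<close>, for the tangent map of \<open>x \<mapsto> g \<cdot> x\<close> at \<open>x\<close>.\<close>

definition tangent_act :: "real^('d + unit)^('d + unit) \<Rightarrow> real^'d \<Rightarrow> real^'d \<Rightarrow> real^'d" where
  "tangent_act g x f = frechet_derivative (aff_act g) (at x) f"

text \<open>\<open>\<xi> \<cdot> x\<close>, the derivative at the identity of the orbit map \<open>g \<mapsto> g \<cdot> x\<close> in the
  direction \<open>\<xi>\<close>. The orbit map is taken on all matrices, where it is linear; on elements of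
  the Lie algebra this does not depend on the extension.\<close>

definition inf_act :: "real^('d + unit)^('d + unit) \<Rightarrow> real^'d \<Rightarrow> real^'d" where
  "inf_act \<xi> x = frechet_derivative (\<lambda>g. aff_act g x) (at (mat 1)) \<xi>"

lemma tangent_act_block: "tangent_act (block h a s) x f = h *v f"
proof -
  have "((\<lambda>x. h *v x + a) has_derivative (*v) h) (at x)"
    by (auto intro!: derivative_eq_intros matrix_vector_mul_bounded_linear[THEN bounded_linear.has_derivative])
  then show ?thesis
    by (simp add: tangent_act_def aff_act_block[abs_def] frechet_derivative_at[symmetric])
qed

lemma inf_act_block: "inf_act (block A b s) x = A *v x + b"
proof -
  have "linear (\<lambda>g. aff_act g x)"
    by (rule linearI)
       (simp_all add: vec_eq_iff aff_act_nth sum.distrib distrib_right distrib_left sum_distrib_left mult.assoc)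
  then have "((\<lambda>g. aff_act g x) has_derivative (\<lambda>g. aff_act g x)) (at (mat 1))"
    by (rule linear_imp_has_derivative)
  then have "frechet_derivative (\<lambda>g. aff_act g x) (at (mat 1)) = (\<lambda>g. aff_act g x)"
    by (rule frechet_derivative_at[symmetric])
  then show ?thesis
    by (simp add: inf_act_def aff_act_block)
qed

definition adjoint_act ::
  "real^('d::finite + unit)^('d + unit) \<Rightarrow> real^('d + unit)^('d + unit) \<Rightarrow> real^('d + unit)^('d + unit)" where
  "adjoint_act g \<xi> = g ** \<xi> ** matrix_inv g"

subsection \<open>Reductive structures and connections\<close>

definition isotropy_group :: "(real^'d^'d) set \<Rightarrow> (real^('d + unit)^('d + unit)) set" where
  "isotropy_group H = {g \<in> aff_group H. aff_act g 0 = 0}"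

definition isotropy_algebra :: "(real^'d^'d) topology \<Rightarrow> (real^('d + unit)^('d + unit)) set" where
  "isotropy_algebra X = {block A 0 0 |A. A \<in> lie_algebra X}"

lemma isotropy_group_eq: "isotropy_group H = {block h 0 1 |h. h \<in> H}"
  by (force simp: isotropy_group_def aff_group_def aff_act_block)

definition reductive_structure ::
  "(real^'d^'d) set \<Rightarrow> (real^'d^'d) topology \<Rightarrow> (real^('d + unit)^('d + unit)) set \<Rightarrow> bool" where
  "reductive_structure H X \<mm> \<longleftrightarrow>
     subspace \<mm> \<and> \<mm> \<subseteq> aff_algebra X \<and>
     aff_algebra X = {\<xi> + \<eta> |\<xi> \<eta>. \<xi> \<in> isotropy_algebra X \<and> \<eta> \<in> \<mm>} \<and>
     isotropy_algebra X \<inter> \<mm> = {0} \<and>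
     (\<forall>h\<in>isotropy_group H. \<forall>\<xi>\<in>\<mm>. adjoint_act h \<xi> \<in> \<mm>)"

text \<open>\<open>\<omega> x f\<close> stands for \<open>\<langle>\<omega>, f\<rangle>\<^sub>x\<close>. By linearity, smoothness of the one-form is smoothness
  of \<open>x \<mapsto> \<langle>\<omega>, f\<rangle>\<^sub>x\<close> for each constant vector \<open>f\<close>.\<close>

definition algebra_valued_one_form ::
  "(real^'d^'d) topology \<Rightarrow> (real^'d \<Rightarrow> real^'d \<Rightarrow> real^('d + unit)^('d + unit)) \<Rightarrow> bool" where
  "algebra_valued_one_form X \<omega> \<longleftrightarrow>
     (\<forall>x. linear (\<omega> x)) \<and> (\<forall>x f. \<omega> x f \<in> aff_algebra X) \<and> (\<forall>f. smooth_on UNIV (\<lambda>x. \<omega> x f))"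

definition connection ::
  "(real^'d^'d) set \<Rightarrow> (real^'d^'d) topology \<Rightarrow>
   (real^'d \<Rightarrow> real^'d \<Rightarrow> real^('d + unit)^('d + unit)) \<Rightarrow> bool" where
  "connection H X \<omega> \<longleftrightarrow>
     algebra_valued_one_form X \<omega> \<and>
     (\<forall>x f. inf_act (\<omega> x f) x = f) \<and>
     (\<forall>g\<in>aff_group H. \<forall>x f. \<omega> (aff_act g x) (tangent_act g x f) = adjoint_act g (\<omega> x f))"

end

theory Submission
  imports Defs
begin

text \<open>
  The relation \<open>Id \<in> \<hh>\<close> is a statement about the manifold topology of \<open>H\<close>, which may be
  finer than the Euclidean one. A Euclidean closed piece \<open>K\<close> of a slice chart is a neighbourhood of
  the identity in \<open>H\<close>, and by second countability countably many translates of \<open>K\<close> cover \<open>H\<close>. By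
  Baire's theorem one of them contains an interval of scalings; since the two topologies agree
  on \<open>K\<close>, translating this interval back shows that the scalings near the identity form a smooth
  curve in \<open>H\<close>. For the rest, conjugation by the scaling \<open>2 Id\<close> fixes the linear part of an
  element of the Lie algebra and doubles its translation part, which separates the two parts.
\<close>

subsection \<open>The scalings in an immersed subgroup\<close>

lemma Ck_on_const: "Ck_on k S (\<lambda>x. c)"
proof (induction k arbitrary: c)
  case (Suc k)
  then show ?case
    by (simp add: frechet_derivative_const)
qed simp

lemma smooth_on_const: "smooth_on S (\<lambda>x. c)"
  by (simp add: smooth_on_def Ck_on_const)

text \<open>The derivative is \<open>f\<close> at every point, so each directional derivative is a
  constant map and no induction on the order is needed. It is applied to the curve of
  scalings.\<close>

lemma smooth_on_affine:
  assumes "bounded_linear f"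
  shows "smooth_on S (\<lambda>x. c + f x)"
proof -
  have der: "((\<lambda>x. c + f x) has_derivative f) (at x)" for x
    using bounded_linear_imp_has_derivative[OF assms] by (auto intro!: derivative_eq_intros)
  then have diff: "(\<lambda>x. c + f x) differentiable (at x)" for x
    by (auto simp: differentiable_def)
  have "frechet_derivative (\<lambda>x. c + f x) (at x) = f" for x
    using frechet_derivative_at[OF der] by simp
  then have "Ck_on k S (\<lambda>x. c + f x)" for k
    using diff by (cases k) (auto simp: Ck_on_const intro!: differentiable_imp_continuous_on
        differentiable_at_imp_differentiable_on)
  then show ?thesis
    by (simp add: smooth_on_def)
qed

text \<open>In a chart, \<open>W\<close> is the preimage of the linear subspace \<open>V\<close>,
  which is closed; over a closed ball inside the chart domain this preimage is closed in the whole
  space. Baire's theorem needs such closedness, which \<open>W\<close> itself may lack.\<close>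

lemma embedded_submanifold_closed_piece:
  fixes W :: "'a::euclidean_space set"
  assumes "embedded_submanifold W" "p \<in> W"
  obtains r where "r > 0" "closed (W \<inter> cball p r)"
proof -
  obtain U U' \<Psi> \<Phi> V where chart: "open U \<and> open U' \<and> p \<in> U \<and> subspace (V::'a set) \<and>
      homeomorphism U U' \<Psi> \<Phi> \<and> smooth_on U \<Psi> \<and> smooth_on U' \<Phi> \<and> \<Psi> ` (W \<inter> U) = V \<inter> U'"
    using bspec[OF assms(1)[unfolded embedded_submanifold_def] assms(2)] by (elim exE)
  then have U: "open U" "p \<in> U" and V: "subspace V"
    and hom: "homeomorphism U U' \<Psi> \<Phi>" and im: "\<Psi> ` (W \<inter> U) = V \<inter> U'"
    by simp_all
  obtain r where r: "r > 0" "cball p r \<subseteq> U"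
    using U open_contains_cball by blast
  have "W \<inter> cball p r = cball p r \<inter> \<Psi> -` V"
  proof (intro equalityI subsetI)
    fix x assume "x \<in> W \<inter> cball p r"
    then show "x \<in> cball p r \<inter> \<Psi> -` V"
      using r im by blast
  next
    fix x assume x: "x \<in> cball p r \<inter> \<Psi> -` V"
    then have xU: "x \<in> U"
      using r by blast
    then have "\<Psi> x \<in> V \<inter> U'"
      using x hom by (auto simp: homeomorphism_def)
    then obtain y where y: "y \<in> W" "y \<in> U" "\<Psi> y = \<Psi> x"
      using im by (metis (no_types, lifting) IntE imageE)
    then have "y = x"
      using hom xU by (metis homeomorphism_apply1)
    then show "x \<in> W \<inter> cball p r"
      using x y by simp
  qed
  moreover have "closed (cball p r \<inter> \<Psi> -` V)"
    using hom r V closed_subspace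
    by (intro continuous_closed_preimage)
       (auto simp: homeomorphism_def intro: continuous_on_subset)
  ultimately show ?thesis
    using that r by metis
qed

section \<open>Matrix inverses and left translations\<close>

lemma scaling_matrix_mult: "A ** (r *\<^sub>R mat 1) = r *\<^sub>R (A :: real^'n^'n)"
  by (simp add: matrix_scalar_ac)

lemma matrix_mult_scaleR_right: "A ** (r *\<^sub>R B) = r *\<^sub>R (A ** B :: real^'n^'n)"
  by (simp add: matrix_scalar_ac scalar_matrix_assoc)

lemma matrix_inv_eqI:
  fixes A B :: "real^'n^'n"
  assumes "A ** B = mat 1"
  shows "matrix_inv A = B"
proof -
  have "B ** A = mat 1"
    using assms matrix_left_right_inverse by blast
  have "invertible A"
    using assms \<open>B ** A = mat 1\<close> by (auto simp: invertible_def)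
  then have "matrix_inv A ** A = mat 1"
    unfolding matrix_inv_def invertible_def by (rule someI2_ex) simp
  then show ?thesis
    using assms by (metis matrix_mul_assoc matrix_mul_lid matrix_mul_rid)
qed

lemma subgroup_GL_inverse:
  assumes "subgroup H GL" "A \<in> H"
  obtains B where "B \<in> H" "A ** B = mat 1" "B ** A = mat 1"
proof -
  interpret group "GL :: (real^'a^'a) monoid" by (rule group_GL)
  have "inv\<^bsub>GL\<^esub> A \<in> H" "A \<in> carrier GL"
    using assms subgroup.m_inv_closed subgroup.mem_carrier by metis+
  then show ?thesis
    using that r_inv l_inv by (metis GL_def monoid.select_convs(1,2))
qed

lemma lie_subgroup_left_mult:
  assumes "lie_subgroup H X" "A \<in> H"
  shows "continuous_map X X (\<lambda>B. A ** B)"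
proof -
  have "topspace X = H" and mult: "continuous_map (prod_topology X X) X (\<lambda>(A, B). A ** B)"
    using assms by (auto simp: lie_subgroup_def immersed_submanifold_def)
  then have "continuous_map X (prod_topology X X) (\<lambda>B. (A, B))"
    using assms by (simp add: continuous_map_pairedI)
  from continuous_map_compose[OF this mult] show ?thesis
    by (simp add: o_def)
qed

text \<open>Each \<open>h\<close> lies in the preimage of \<open>N\<close> under left multiplication
  by its own inverse. These preimages are open in \<open>X\<close>, and second countability makes
  \<open>X\<close> Lindelof.\<close>

lemma countable_translates_cover:
  assumes "lie_subgroup H X" and N: "openin X N" "mat 1 \<in> N"
  obtains C where "countable C" "C \<subseteq> H" "\<And>h. h \<in> H \<Longrightarrow> \<exists>g\<in>C. g ** h \<in> N"
proof -
  have top: "topspace X = H" and sub: "subgroup H GL" and "second_countable X"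
    using assms by (auto simp: lie_subgroup_def immersed_submanifold_def)
  then have "Lindelof_space X"
    by (simp add: second_countable_imp_Lindelof_space)
  let ?U = "\<lambda>g. {h \<in> H. g ** h \<in> N}"
  have "openin X (?U g)" if "g \<in> H" for g
    using openin_continuous_map_preimage[OF lie_subgroup_left_mult[OF assms(1) that] N(1)] top
    by simp
  moreover have "\<Union> (?U ` H) = topspace X"
  proof -
    have "\<exists>g\<in>H. g ** h \<in> N" if "h \<in> H" for h
      using subgroup_GL_inverse[OF sub that] N(2) by metis
    then show ?thesis
      using top by blast
  qed
  ultimately have "\<exists>\<V>. countable \<V> \<and> \<V> \<subseteq> ?U ` H \<and> \<Union>\<V> = topspace X"
    by (intro Lindelof_spaceD[OF \<open>Lindelof_space X\<close>]) blast+
  then obtain \<V> where \<V>: "countable \<V> \<and> \<V> \<subseteq> ?U ` H" "\<Union>\<V> = topspace X"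
    by blast
  then obtain C where C: "countable C" "C \<subseteq> H" "\<V> = ?U ` C"
    unfolding countable_subset_image by blast
  then have "\<exists>g\<in>C. g ** h \<in> N" if "h \<in> H" for h
    using that \<V>(2) top by auto
  then show ?thesis
    using that C by blast
qed

lemma mat_1_in_lie_algebra:
  fixes H :: "(real^'d^'d) set"
  assumes lie: "lie_subgroup H X" and scal: "\<forall>r>0. r *\<^sub>R mat 1 \<in> H"
  shows "mat 1 \<in> lie_algebra X"
proof -
  have sub: "subgroup H GL" and imm: "immersed_submanifold H X"
    using lie by (auto simp: lie_subgroup_def)
  have one: "mat 1 \<in> H"
    using scal[rule_format, of 1] by simp
  then obtain W where W: "openin X W" "mat 1 \<in> W" "embedded_submanifold W"
    "subtopology X W = top_of_set W"
    using imm by (auto simp: immersed_submanifold_def)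
  obtain \<rho> where \<rho>: "\<rho> > 0" "closed (W \<inter> cball (mat 1) \<rho>)"
    using embedded_submanifold_closed_piece W by metis
  let ?K = "W \<inter> cball (mat 1) \<rho>"
  \<comment> \<open>The open ball gives an \<open>X\<close>-open neighbourhood for the countable
    cover; the closed ball gives the closed set \<open>?K\<close> for Baire's theorem.\<close>
  have "openin (top_of_set W) (W \<inter> ball (mat 1) \<rho>)"
    by (simp add: openin_open_Int)
  then have N: "openin X (W \<inter> ball (mat 1) \<rho>)"
    using W openin_trans_full by metis
  obtain C where C: "countable C" "C \<subseteq> H"
    "\<And>h. h \<in> H \<Longrightarrow> \<exists>g\<in>C. g ** h \<in> W \<inter> ball (mat 1) \<rho>"
    using countable_translates_cover[OF lie N] W \<rho> by auto
  \<comment> \<open>Since \<open>g ** (t *\<^sub>R mat 1) = t *\<^sub>R g\<close>, the set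
    \<open>?F g\<close> consists of the t in [1,2] whose scaling is moved into \<open>?K\<close> by
    \<open>g\<close>.\<close>
  let ?F = "\<lambda>g. {1..2} \<inter> (\<lambda>t::real. t *\<^sub>R g) -` ?K"
  have F: "closed (?F g)" for g
    by (intro continuous_closed_preimage \<rho> continuous_intros closed_atLeastAtMost)
  have cover: "{1..2} \<subseteq> \<Union> (?F ` C)"
  proof
    fix t :: real assume t: "t \<in> {1..2}"
    then have "t *\<^sub>R mat 1 \<in> H"
      using scal by simp
    then obtain g where "g \<in> C" "t *\<^sub>R g \<in> W \<inter> ball (mat 1) \<rho>"
      using C(3) by (metis scaling_matrix_mult)
    then show "t \<in> \<Union> (?F ` C)"
      using t by force
  qed
  \<comment> \<open>Otherwise countably many closed sets with empty interior would cover
    [1,2].\<close>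
  have "\<exists>g\<in>C. interior (?F g) \<noteq> {}"
  proof (rule ccontr)
    assume "\<not> ?thesis"
    then have "euclidean interior_of \<Union> (?F ` C) = {}"
      using C(1) F by (intro Baire_category_alt) (auto simp: completely_metrizable_space_euclidean)
    moreover have "interior {1..2::real} \<subseteq> interior (\<Union> (?F ` C))"
      using cover by (rule interior_mono)
    moreover have "interior {1..2::real} \<noteq> {}"
      by simp
    ultimately show False
      by simp
  qed
  then obtain g t0 where g: "g \<in> C" and "t0 \<in> interior (?F g)"
    by blast
  then obtain e where e: "e > 0" "ball t0 e \<subseteq> ?F g"
    by (meson mem_interior)
  then have t0: "t0 \<ge> 1"
    by (meson IntD1 atLeastAtMost_iff centre_in_ball subsetD)
  \<comment> \<open>The centre of the interval found on the ray through \<open>g\<close> is taken as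
    the new base point; dividing \<open>e\<close> by \<open>t0\<close> converts the additive radius
    around \<open>t0\<close> into a bound on the relative change \<open>s\<close>.\<close>
  define a where "a = t0 *\<^sub>R g"
  define \<epsilon> where "\<epsilon> = e / t0"
  have \<epsilon>: "\<epsilon> > 0"
    using e t0 by (simp add: \<epsilon>_def)
  have inW: "(1 + s) *\<^sub>R a \<in> W" if "s \<in> {-\<epsilon><..<\<epsilon>}" for s
  proof -
    have "\<bar>s\<bar> * t0 < e"
      using that t0 by (auto simp: \<epsilon>_def field_simps abs_if)
    then have "(1 + s) * t0 \<in> ball t0 e"
      using t0 by (simp add: dist_real_def algebra_simps abs_mult)
    then have "((1 + s) * t0) *\<^sub>R g \<in> ?K"
      using e(2) by blast
    then show ?thesis
      by (simp add: a_def)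
  qed
  have "a \<in> W"
    using inW[of 0] \<epsilon> by simp
  then have "a \<in> H"
    using openin_subset[OF W(1)] imm by (auto simp: immersed_submanifold_def)
  then obtain b where b: "b \<in> H" "b ** a = mat 1"
    using subgroup_GL_inverse[OF sub] by metis
  \<comment> \<open>With \<open>b\<close> the inverse of \<open>a\<close>, left translation by
    \<open>b\<close> carries the segment through \<open>a\<close> in \<open>W\<close> to the curve
    (1 + s) Id through the identity.\<close>
  let ?c = "\<lambda>s::real. mat 1 + s *\<^sub>R mat 1 :: real^'d^'d"
  have c: "?c = (\<lambda>s. b ** ((1 + s) *\<^sub>R a))"
    unfolding matrix_mult_scaleR_right b(2) by (simp add: scaleR_add_left)
  \<comment> \<open>Euclidean continuity suffices inside \<open>W\<close>, where \<open>X\<close>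
    induces the Euclidean topology; translation by \<open>b\<close> is then continuous for
    \<open>X\<close>.\<close>
  have "continuous_map (top_of_set {-\<epsilon><..<\<epsilon>}) (top_of_set W) (\<lambda>s. (1 + s) *\<^sub>R a)"
    using inW by (auto intro!: continuous_intros)
  then have "continuous_map (top_of_set {-\<epsilon><..<\<epsilon>}) X (\<lambda>s. (1 + s) *\<^sub>R a)"
    using W(4) by (metis continuous_map_into_fulltopology)
  from continuous_map_compose[OF this lie_subgroup_left_mult[OF lie b(1)]]
  have "continuous_map (top_of_set {-\<epsilon><..<\<epsilon>}) X ?c"
    unfolding c by (simp add: o_def)
  moreover have "smooth_on {-\<epsilon><..<\<epsilon>} ?c"
    by (intro smooth_on_affine bounded_linear_scaleR_left)
  moreover have "(?c has_vector_derivative mat 1) (at 0)"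
    by (auto intro!: derivative_eq_intros)
  ultimately show ?thesis
    using \<epsilon> unfolding lie_algebra_def by (auto intro!: exI[of _ \<epsilon>] exI[of _ ?c])
qed

text \<open>The velocity of the constant curve at the identity. It places the pure translations
  inside \<open>aff_algebra X\<close>.\<close>

lemma zero_in_lie_algebra:
  assumes "lie_subgroup H X"
  shows "0 \<in> lie_algebra X"
proof -
  have "subgroup H GL" "topspace X = H"
    using assms by (auto simp: lie_subgroup_def immersed_submanifold_def)
  then have "mat 1 \<in> topspace X"
    using subgroup.one_closed by (force simp: GL_def)
  then show ?thesis
    unfolding lie_algebra_def
    by (auto intro!: exI[of _ "1::real"] exI[of _ "\<lambda>_::real. mat 1"] smooth_on_const)
qed

subsection \<open>Block matrices\<close>

lemma sum_UNIV_plus_unit: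
  "sum f (UNIV :: ('d::finite + unit) set) = (\<Sum>l\<in>UNIV. f (Inl l)) + (f (Inr ()) :: real)"
  by (simp add: UNIV_Plus_UNIV[symmetric] sum.Plus UNIV_unit del: UNIV_Plus_UNIV)

lemma block_mult:
  "block A b s ** block A' b' s' = block (A ** A') (A *v b' + s' *\<^sub>R b) (s * s')"
  by (auto simp: vec_eq_iff block_def matrix_matrix_mult_def matrix_vector_mult_def
      sum_UNIV_plus_unit split: sum.splits)

lemma block_eq_iff: "block A b s = block A' b' s' \<longleftrightarrow> A = A' \<and> b = b' \<and> s = s'"
proof
  assume eq: "block A b s = block A' b' s'"
  have "block A b s $ i $ j = block A' b' s' $ i $ j" for i j
    by (simp add: eq)
  from this[of "Inl _" "Inl _"] this[of "Inl _" "Inr ()"] this[of "Inr ()" "Inr ()"]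
  show "A = A' \<and> b = b' \<and> s = s'"
    by (simp add: block_def vec_eq_iff)
qed simp

lemma block_add: "block A b s + block A' b' s' = block (A + A') (b + b') (s + s')"
  by (auto simp: vec_eq_iff block_def split: sum.splits)

lemma block_diff: "block A b s - block A' b' s' = block (A - A') (b - b') (s - s')"
  by (auto simp: vec_eq_iff block_def split: sum.splits)

lemma block_scaleR: "r *\<^sub>R block A b s = block (r *\<^sub>R A) (r *\<^sub>R b) (r * s)"
  by (auto simp: vec_eq_iff block_def split: sum.splits)

lemma block_0: "block 0 0 0 = 0"
  by (auto simp: vec_eq_iff block_def split: sum.splits)

lemma block_mat_1: "block (mat 1) 0 1 = mat 1"
  by (auto simp: vec_eq_iff block_def mat_def split: sum.splits)

text \<open>The inverse of (h, a) is (h', -h'a). Conjugation never feeds the translation part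
  \<open>b\<close> into the linear part, so elements with \<open>A = 0\<close> stay
  translations.\<close>

lemma adjoint_act_block:
  assumes "h ** h' = mat 1"
  shows "adjoint_act (block h a 1) (block A b 0)
    = block (h ** A ** h') (h *v b - (h ** A ** h') *v a) 0"
proof -
  have "block h a 1 ** block h' (- (h' *v a)) 1 = mat 1"
    using assms by (simp add: block_mult matrix_vector_mul_assoc linear_neg[OF matrix_vector_mul_linear] block_mat_1)
  then have "matrix_inv (block h a 1) = block h' (- (h' *v a)) 1"
    by (rule matrix_inv_eqI)
  then show ?thesis
    by (simp add: adjoint_act_def block_mult matrix_vector_mul_assoc block_eq_iff
        linear_neg[OF matrix_vector_mul_linear])
qed

text \<open>Scalar matrices are central, so conjugation affects only the translation part.\<close>

lemma adjoint_act_scaling: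
  assumes "r > 0"
  shows "adjoint_act (block (r *\<^sub>R mat 1) 0 1) (block A b 0) = block A (r *\<^sub>R b) 0"
proof -
  have "r *\<^sub>R mat 1 ** (inverse r *\<^sub>R mat 1) = (mat 1 :: real^'a^'a)"
    using assms by (simp add: scaling_matrix_mult)
  from adjoint_act_block[OF this, of 0 A b] show ?thesis
    using assms by (simp add: scaling_matrix_mult scalar_matrix_assoc[symmetric] scaleR_matrix_vector_assoc[symmetric])
qed

subsection \<open>Reductive structures and connections\<close>

lemma reductive_translation_space:
  assumes "lie_subgroup H X"
  shows "reductive_structure H X translation_space"
proof -
  have zero: "0 \<in> lie_algebra X"
    using assms by (rule zero_in_lie_algebra)
  have "subspace (translation_space :: (real^('a + unit)^('a + unit)) set)"
    by (auto simp: subspace_def translation_space_def block_add block_scaleR block_eq_iff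
        block_0[symmetric])
  moreover have "translation_space \<subseteq> aff_algebra X"
    using zero by (auto simp: translation_space_def aff_algebra_def)
  moreover have "aff_algebra X = {\<xi> + \<eta> |\<xi> \<eta>. \<xi> \<in> isotropy_algebra X \<and> \<eta> \<in> translation_space}"
  proof -
    have "block A b 0 = block A 0 0 + block 0 b 0" for A :: "real^'a^'a" and b
      by (simp add: block_add)
    then have "\<exists>\<xi> \<eta>. block A b 0 = \<xi> + \<eta> \<and> \<xi> \<in> isotropy_algebra X \<and> \<eta> \<in> translation_space"
      if "A \<in> lie_algebra X" for A b
      using that unfolding isotropy_algebra_def translation_space_def by blast
    moreover have "\<xi> + \<eta> \<in> aff_algebra X"
      if "\<xi> \<in> isotropy_algebra X" "\<eta> \<in> translation_space" for \<xi> \<eta>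
      using that
      unfolding aff_algebra_def isotropy_algebra_def translation_space_def
      by (auto simp: block_add block_eq_iff)
    ultimately show ?thesis
      by (auto simp: aff_algebra_def)
  qed
  moreover have "isotropy_algebra X \<inter> translation_space = {0}"
    using zero
    by (auto simp: isotropy_algebra_def translation_space_def block_eq_iff block_0[symmetric])
  moreover have "adjoint_act g \<xi> \<in> translation_space"
    if "g \<in> isotropy_group H" "\<xi> \<in> translation_space" for g \<xi>
  proof -
    obtain h b where hb: "h \<in> H" "g = block h 0 1" "\<xi> = block 0 b 0"
      using \<open>g \<in> isotropy_group H\<close> \<open>\<xi> \<in> translation_space\<close>
      by (auto simp: isotropy_group_eq translation_space_def)
    moreover obtain h' where "h ** h' = mat 1"
      using assms \<open>h \<in> H\<close> subgroup_GL_inverse unfolding lie_subgroup_def by metis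
    ultimately show ?thesis
      using adjoint_act_block[of h h' 0 0 b] by (auto simp: translation_space_def)
  qed
  ultimately show ?thesis
    unfolding reductive_structure_def by blast
qed

lemma reductive_structure_unique:
  assumes scal: "\<forall>r>0. r *\<^sub>R mat 1 \<in> H" and red: "reductive_structure H X \<mm>"
  shows "\<mm> = translation_space"
proof -
  have m: "subspace \<mm>" "\<mm> \<subseteq> aff_algebra X" "isotropy_algebra X \<inter> \<mm> = {0}"
    and sum: "aff_algebra X = {\<xi> + \<eta> |\<xi> \<eta>. \<xi> \<in> isotropy_algebra X \<and> \<eta> \<in> \<mm>}"
    and inv: "\<And>h \<xi>. h \<in> isotropy_group H \<Longrightarrow> \<xi> \<in> \<mm> \<Longrightarrow> adjoint_act h \<xi> \<in> \<mm>"
    using red by (auto simp: reductive_structure_def)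
  have no_linear: "A = 0" if mem: "block A b 0 \<in> \<mm>" for A b
  proof -
    have "A \<in> lie_algebra X"
      using mem m(2) by (auto simp: aff_algebra_def block_eq_iff)
    then have iso: "block A 0 0 \<in> isotropy_algebra X"
      by (auto simp: isotropy_algebra_def)
    have "block (2 *\<^sub>R mat 1) 0 1 \<in> isotropy_group H"
      using scal by (auto simp: isotropy_group_eq)
    then have "block A (2 *\<^sub>R b) 0 \<in> \<mm>"
      using inv mem adjoint_act_scaling[of 2 A b] by fastforce
    \<comment> \<open>Subtracting the original element from its conjugate isolates (0, b), and
      removing this leaves (A, 0), which lies in both summands of the direct sum.\<close>
    then have "block A b 0 - (block A (2 *\<^sub>R b) 0 - block A b 0) \<in> \<mm>"
      using m(1) mem by (intro subspace_diff)
    then have "block A 0 0 \<in> \<mm>"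
      by (simp add: block_diff scaleR_2)
    then have "block A 0 0 = block 0 0 0"
      using iso m(3) by (auto simp: block_0)
    then show ?thesis
      by (simp add: block_eq_iff)
  qed
  show ?thesis
  proof
    show "\<mm> \<subseteq> translation_space"
      using m(2) no_linear by (fastforce simp: aff_algebra_def translation_space_def)
    show "translation_space \<subseteq> \<mm>"
    proof
      fix \<zeta> :: "real^('a + unit)^('a + unit)" assume "\<zeta> \<in> translation_space"
      then obtain b where \<zeta>: "\<zeta> = block 0 b 0"
        by (auto simp: translation_space_def)
      \<comment> \<open>The zero of \<mm> lies in \<open>aff_algebra X\<close>, which yields
        \<open>0 \<in> lie_algebra X\<close> and lets the translation \<zeta> be decomposed.\<close>
      have "0 \<in> \<mm>"
        using m(1) by (rule subspace_0)
      then have "0 \<in> lie_algebra X"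
        using m(2) by (auto simp: aff_algebra_def block_0[symmetric] block_eq_iff)
      then have "\<zeta> \<in> aff_algebra X"
        using \<zeta> by (auto simp: aff_algebra_def)
      then obtain A \<eta> where \<eta>: "\<zeta> = block A 0 0 + \<eta>" "\<eta> \<in> \<mm>"
        unfolding sum isotropy_algebra_def by blast
      moreover obtain A' b' where "\<eta> = block A' b' 0"
        using \<eta>(2) m(2) by (auto simp: aff_algebra_def)
      \<comment> \<open>The component \<eta> has no linear part, so comparing linear parts forces
        \<open>A = 0\<close> and \<zeta> = \<eta>.\<close>
      ultimately show "\<zeta> \<in> \<mm>"
        using no_linear[of A' b'] \<zeta> by (auto simp: block_add block_eq_iff)
    qed
  qed
qed

section \<open>Connections\<close>

lemma connection_translation:
  assumes "lie_subgroup H X"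
  shows "connection H X (\<lambda>x f. block 0 f 0)"
proof -
  have "linear (\<lambda>f. block 0 f 0 :: real^('a + unit)^('a + unit))"
    by (rule linearI) (simp_all add: block_add block_scaleR)
  moreover have "block 0 f 0 \<in> aff_algebra X" for f
    using zero_in_lie_algebra[OF assms] by (auto simp: aff_algebra_def)
  \<comment> \<open>For g = (h, a) both sides are the translation by hf, since the tangent map of g
    is h.\<close>
  moreover have "block 0 (tangent_act g x f) 0 = adjoint_act g (block 0 f 0)"
    if "g \<in> aff_group H" for g x f
  proof -
    obtain h a where h: "h \<in> H" "g = block h a 1"
      using \<open>g \<in> aff_group H\<close> by (auto simp: aff_group_def)
    moreover obtain h' where "h ** h' = mat 1"
      using assms h(1) subgroup_GL_inverse unfolding lie_subgroup_def by metis
    ultimately show ?thesis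
      using adjoint_act_block[of h h' a 0 f] by (simp add: tangent_act_block)
  qed
  ultimately show ?thesis
    by (simp add: connection_def algebra_valued_one_form_def smooth_on_const inf_act_block)
qed

text \<open>The scaling by 2 fixes the origin, so there equivariance leaves the linear part
  \<open>A\<close> unchanged while linearity of the form doubles it; hence \<open>A = 0\<close>.
  Equivariance under translations carries the value at the origin to every point.\<close>

lemma connection_unique:
  assumes scal: "\<forall>r>0. r *\<^sub>R mat 1 \<in> H" and con: "connection H X \<omega>"
  shows "\<omega> x f = block 0 f 0"
proof -
  have equi: "\<omega> (aff_act g x) (tangent_act g x f) = adjoint_act g (\<omega> x f)"
    if "g \<in> aff_group H" for g x f
    using con that by (simp add: connection_def)
  have "\<omega> 0 f \<in> aff_algebra X" and lin: "linear (\<omega> 0)" and inf: "inf_act (\<omega> 0 f) 0 = f"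
    using con by (auto simp: connection_def algebra_valued_one_form_def)
  then obtain A b where A: "\<omega> 0 f = block A b 0"
    by (auto simp: aff_algebra_def)
  then have "b = f"
    using inf by (simp add: inf_act_block)
  have "block (2 *\<^sub>R mat 1) 0 1 \<in> aff_group H"
    using scal by (auto simp: aff_group_def)
  from equi[OF this, of 0 f] have "\<omega> 0 (2 *\<^sub>R f) = block A (2 *\<^sub>R b) 0"
    by (simp add: aff_act_block tangent_act_block adjoint_act_scaling A
        scaleR_matrix_vector_assoc[symmetric])
  moreover have "\<omega> 0 (2 *\<^sub>R f) = block (2 *\<^sub>R A) (2 *\<^sub>R b) 0"
    using linear_scale[OF lin, of 2 f] by (simp add: A block_scaleR)
  ultimately have "A = 0"
    by (simp add: block_eq_iff scaleR_2)
  \<comment> \<open>Translation by \<open>x\<close> sends the origin to \<open>x\<close>, has the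
    identity as tangent map, and its adjoint action fixes \<open>block 0 f 0\<close>.\<close>
  have "block (mat 1) x 1 \<in> aff_group H"
    using scal[rule_format, of 1] by (auto simp: aff_group_def)
  from equi[OF this, of 0 f] show ?thesis
    using adjoint_act_block[of "mat 1" "mat 1" x 0 f] \<open>A = 0\<close> \<open>b = f\<close> A
    by (simp add: aff_act_block tangent_act_block)
qed

theorem proposition5p3:
  fixes H :: "(real^'d^'d) set" and X :: "(real^'d^'d) topology"
  assumes "lie_subgroup H X"
    and "\<forall>r>0. r *\<^sub>R mat 1 \<in> H"
  shows "mat 1 \<in> lie_algebra X \<and>
    (\<forall>\<mm>. reductive_structure H X \<mm> \<longleftrightarrow> \<mm> = translation_space) \<and>
    (\<forall>\<omega>. connection H X \<omega> \<longleftrightarrow> (\<forall>x \<delta>x. \<omega> x \<delta>x = block 0 \<delta>x 0))"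
proof (intro conjI allI iffI)
  show "mat 1 \<in> lie_algebra X"
    using assms by (rule mat_1_in_lie_algebra)
  show "\<mm> = translation_space" if "reductive_structure H X \<mm>" for \<mm>
    using assms(2) that by (rule reductive_structure_unique)
  show "reductive_structure H X \<mm>" if "\<mm> = translation_space" for \<mm>
    using reductive_translation_space[OF assms(1)] that by simp
  show "\<omega> x \<delta>x = block 0 \<delta>x 0" if "connection H X \<omega>" for \<omega> x \<delta>x
    using assms(2) that by (rule connection_unique)
  show "connection H X \<omega>" if "\<forall>x \<delta>x. \<omega> x \<delta>x = block 0 \<delta>x 0" for \<omega>
  proof -
    have "\<omega> = (\<lambda>x f. block 0 f 0)"
      using that by blast
    then show ?thesis
      using connection_translation[OF assms(1)] by simp
  qed
qed

end
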